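(* For every instance of problem FM with $m=3$ machines (and any number of jobs with nonnegative real processing times), every LD schedule satisfies $t_{LD}\le \frac{13}{11}\,t^*$; that is, the Coffman–Sethi conjecture holds for $m=3$.
   Context: Problem FM: there are $m\ge 1$ identical parallel machines and $n=mk$ jobs ($k\ge 1$ is the number of ranks; an instance with fewer jobs is padded with jobs of processing time $0$), with nonnegative real processing times indexed so that $p_1\ge p_2\ge\cdots\ge p_n$. For $r\in\{1,\dots,k\}$, rank $r$ is the set of jobs $(r-1)m+1,\dots,rm$. A flowtime-optimal schedule assigns to every machine exactly one job from each rank and processes the jobs on each machine consecutively from time $0$ without idle time, in the order rank $k$, rank $k-1$, \dots, rank $1$; its makespan is the largest machine completion time. $t^*$ denotes the minimum makespan over all flowtime-optimal schedules. LD algorithm: ranks are handled in the order $1,2,\dots,k$; when handling a rank, the largest job of that rank is assigned to a machine of smallest current load (sum of processing times of jobs already assigned), the second largest to a machine of second smallest load, \dots, the smallest to a machine of largest load (ties broken arbitrarily); at the end the order of jobs on each machine is reversed, yielding a flowtime-optimal schedule. Any schedule obtainable this way is an LD schedule, and $t_{LD}$ denotes its makespan. The Coffman–Sethi conjecture asserts that for every $m$, every instance on $m$ machines and every LD schedule of it, $t_{LD}\le\frac{5m-2}{4m-1}t^*$. *)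

theory Defs
  imports Complex_Main "HOL-Library.FuncSet"
begin

text \<open>
  Machines are numbered \<open>1..m\<close>, ranks \<open>1..k\<close> and jobs \<open>1..m * k\<close>.  A schedule is given by the map
  sending each job to its machine, extended by \<open>undefined\<close> outside the set of jobs; the order
  and the times of processing are determined by this map, see \<open>job_completion\<close>.
\<close>

definition jobs :: "nat \<Rightarrow> nat \<Rightarrow> nat set" where
  "jobs m k = {1..m * k}"

definition machines :: "nat \<Rightarrow> nat set" where
  "machines m = {1..m}"

definition FM_instance :: "nat \<Rightarrow> nat \<Rightarrow> (nat \<Rightarrow> real) \<Rightarrow> bool" where
  "FM_instance m k p \<longleftrightarrow>
     m \<ge> 1 \<and> k \<ge> 1 \<and> (\<forall>i\<in>jobs m k. 0 \<le> p i) \<and> antimono_on (jobs m k) p"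

definition rank_jobs :: "nat \<Rightarrow> nat \<Rightarrow> nat set" where
  "rank_jobs m r = {(r - 1) * m + 1..r * m}"

definition job_rank :: "nat \<Rightarrow> nat \<Rightarrow> nat" where
  "job_rank m i = (i - 1) div m + 1"

definition flowtime_optimal_schedules :: "nat \<Rightarrow> nat \<Rightarrow> (nat \<Rightarrow> nat) set" where
  "flowtime_optimal_schedules m k =
     {s \<in> jobs m k \<rightarrow>\<^sub>E machines m. \<forall>r\<in>{1..k}. bij_betw s (rank_jobs m r) (machines m)}"

text \<open>
  Each machine processes its jobs from time 0 without idle time in the order rank \<open>k\<close>, \dots, rank 1,
  so a job is completed once it and all jobs of higher rank number on its machine are processed.
\<close>

definition job_completion ::
  "nat \<Rightarrow> nat \<Rightarrow> (nat \<Rightarrow> real) \<Rightarrow> (nat \<Rightarrow> nat) \<Rightarrow> nat \<Rightarrow> real" where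
  "job_completion m k p s j =
     (\<Sum>i \<in> {i \<in> jobs m k. s i = s j \<and> job_rank m i \<ge> job_rank m j}. p i)"

definition machine_completion ::
  "nat \<Rightarrow> nat \<Rightarrow> (nat \<Rightarrow> real) \<Rightarrow> (nat \<Rightarrow> nat) \<Rightarrow> nat \<Rightarrow> real" where
  "machine_completion m k p s h = Max (job_completion m k p s ` {j \<in> jobs m k. s j = h})"

definition makespan :: "nat \<Rightarrow> nat \<Rightarrow> (nat \<Rightarrow> real) \<Rightarrow> (nat \<Rightarrow> nat) \<Rightarrow> real" where
  "makespan m k p s = Max (machine_completion m k p s ` machines m)"

definition opt_makespan :: "nat \<Rightarrow> nat \<Rightarrow> (nat \<Rightarrow> real) \<Rightarrow> real" where
  "opt_makespan m k p = Min (makespan m k p ` flowtime_optimal_schedules m k)"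

definition load_before :: "nat \<Rightarrow> (nat \<Rightarrow> real) \<Rightarrow> (nat \<Rightarrow> nat) \<Rightarrow> nat \<Rightarrow> nat \<Rightarrow> real" where
  "load_before m p s r h = (\<Sum>i \<in> {i \<in> (\<Union>q\<in>{1..<r}. rank_jobs m q). s i = h}. p i)"

text \<open>
  When rank \<open>r\<close> is handled, \<open>\<sigma>\<close> lists the machines by nondecreasing current load and \<open>\<tau>\<close> lists the
  jobs of the rank by nonincreasing processing time; the choice of \<open>\<sigma>\<close> and \<open>\<tau>\<close> is the
  tie-breaking.  The final reversal on each machine is already built into \<open>job_completion\<close>.
\<close>

definition LD_schedule :: "nat \<Rightarrow> nat \<Rightarrow> (nat \<Rightarrow> real) \<Rightarrow> (nat \<Rightarrow> nat) \<Rightarrow> bool" where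
  "LD_schedule m k p s \<longleftrightarrow>
     s \<in> jobs m k \<rightarrow>\<^sub>E machines m \<and>
     (\<forall>r\<in>{1..k}. \<exists>\<sigma> \<tau>.
        bij_betw \<sigma> {1..m} (machines m) \<and> mono_on {1..m} (\<lambda>i. load_before m p s r (\<sigma> i)) \<and>
        bij_betw \<tau> {1..m} (rank_jobs m r) \<and> antimono_on {1..m} (\<lambda>i. p (\<tau> i)) \<and>
        (\<forall>i\<in>{1..m}. s (\<tau> i) = \<sigma> i))"

definition Coffman_Sethi :: "nat \<Rightarrow> bool" where
  "Coffman_Sethi m \<longleftrightarrow>
     (\<forall>k p s. FM_instance m k p \<longrightarrow> LD_schedule m k p s \<longrightarrow>
        makespan m k p s \<le> (5 * real m - 2) / (4 * real m - 1) * opt_makespan m k p)"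

lemma mem_rank_jobs_iff:
  assumes "m \<ge> 1" "r \<ge> 1"
  shows "i \<in> rank_jobs m r \<longleftrightarrow> i \<ge> 1 \<and> job_rank m i = r"
proof (cases "i \<ge> 1")
  case True
  then obtain j where j: "i = Suc j" by (cases i) auto
  obtain q where q: "r = Suc q" using assms(2) by (cases r) auto
  have "j div m = q \<longleftrightarrow> q * m \<le> j \<and> j < Suc q * m"
    using assms(1) by (auto simp: div_nat_eqI mult.commute dividend_less_times_div
        intro: times_div_less_eq_dividend)
  then show ?thesis by (auto simp: j q rank_jobs_def job_rank_def)
qed (auto simp: rank_jobs_def)

lemma finite_flowtime_optimal_schedules: "finite (flowtime_optimal_schedules m k)"
  unfolding flowtime_optimal_schedules_def jobs_def machines_def
  by (rule finite_subset[OF _ finite_PiE[of "{1..m * k}" "\<lambda>_. {1..m}"]]) auto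

lemma flowtime_optimal_schedules_nonempty:
  assumes "m \<ge> 1"
  shows "flowtime_optimal_schedules m k \<noteq> {}"
proof -
  define s where "s = restrict (\<lambda>i. (i - 1) mod m + 1) (jobs m k)"
  have "bij_betw s (rank_jobs m r) (machines m)" if r: "r \<in> {1..k}" for r
  proof -
    obtain q where q: "r = Suc q" using r by (cases r) auto
    have "r * m \<le> m * k" using r by simp
    then have sub: "rank_jobs m r \<subseteq> jobs m k"
      by (auto simp: rank_jobs_def jobs_def)
    have inv: "(i - 1) mod m = i - 1 - q * m" if "i \<in> rank_jobs m r" for i
    proof -
      from that have "i - 1 = q * m + (i - 1 - q * m)" "i - 1 - q * m < m"
        by (auto simp: rank_jobs_def q)
      then show ?thesis by (metis mod_less mod_mult_self3)
    qed
    show ?thesis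
    proof (rule bij_betw_byWitness[where f' = "\<lambda>h. q * m + h"])
      show "\<forall>i\<in>rank_jobs m r. q * m + s i = i"
        using sub inv by (auto simp: s_def rank_jobs_def q)
      have *: "q * m + h \<in> rank_jobs m r" if "h \<in> machines m" for h
        using that by (auto simp: rank_jobs_def machines_def q)
      then show "(\<lambda>h. q * m + h) ` machines m \<subseteq> rank_jobs m r" by blast
      show "\<forall>h\<in>machines m. s (q * m + h) = h"
      proof
        fix h assume h: "h \<in> machines m"
        then have "s (q * m + h) = (q * m + h - 1) mod m + 1"
          using *[OF h] sub by (auto simp: s_def)
        then show "s (q * m + h) = h"
          using inv[OF *[OF h]] h by (auto simp: machines_def)
      qed
      show "s ` rank_jobs m r \<subseteq> machines m"
        using sub assms by (auto simp: s_def machines_def Suc_le_eq)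
    qed
  qed
  moreover have "s \<in> jobs m k \<rightarrow>\<^sub>E machines m"
    using assms by (auto simp: s_def machines_def Suc_le_eq)
  ultimately show ?thesis by (auto simp: flowtime_optimal_schedules_def)
qed

lemma LD_schedule_imp_flowtime_optimal:
  assumes "LD_schedule m k p s"
  shows "s \<in> flowtime_optimal_schedules m k"
proof -
  have "bij_betw s (rank_jobs m r) (machines m)" if r: "r \<in> {1..k}" for r
  proof -
    obtain \<sigma> \<tau> where st: "bij_betw \<sigma> {1..m} (machines m)" "bij_betw \<tau> {1..m} (rank_jobs m r)"
      "\<forall>i\<in>{1..m}. s (\<tau> i) = \<sigma> i"
      using assms r unfolding LD_schedule_def by blast
    have "bij_betw (s \<circ> \<tau>) {1..m} (machines m)"
      using st(1,3) bij_betw_cong[of "{1..m}" "s \<circ> \<tau>" \<sigma> "machines m"] by simp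
    then show ?thesis using bij_betw_comp_iff[OF st(2)] by blast
  qed
  then show ?thesis
    using assms by (simp add: LD_schedule_def flowtime_optimal_schedules_def)
qed

end

theory Submission imports Defs begin

text \<open>
  Subtract from every job the smallest processing time of its rank, so that rank \<open>r\<close> (counted
  from 0) becomes \<open>x r \<ge> y r \<ge> 0\<close>. The subtracted amount \<open>C\<close>, the same for every machine, is at
  least \<open>\<Sum>r. r * x r\<close>, so it suffices that reduced LD loads are at most
  \<open>(13 * B + 2 * (\<Sum>r. r * x r)) / 11\<close>, where \<open>B = t\<^sup>* - C\<close>. Of \<open>B\<close> we only use the average load
  bound, \<open>x r \<le> B\<close>, and the pigeonhole bound \<open>y q + y r \<le> B\<close>.

  Induct on the number of ranks. A makespan machine that receives 0 in the last rank is covered by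
  the induction hypothesis, and one that receives \<open>x\<close> by the average bound. If it receives \<open>y\<close>, the
  average bound works provided the gap between the second largest and the smallest load is at most
  some \<open>x q\<close> with \<open>q \<ge> 1\<close>. Otherwise the least loaded machine has been the same one since rank 0
  and has collected all \<open>x q\<close> with \<open>q \<ge> 1\<close>; then the two other loads sum to \<open>x 0\<close> plus all \<open>y q\<close>,
  which bounds the smaller of them.
\<close>

section \<open>LD runs on three machines after the reduction\<close>

lemma three_distinctE:
  assumes "{u, v, w} = {1, 2, 3::nat}"
  obtains "u \<noteq> v" "u \<noteq> w" "v \<noteq> w"
proof -
  have "card {u, v, w} = 3" using assms by simp
  then show ?thesis using that by (auto simp: card_insert_if split: if_splits)
qed

lemma sum_three:
  fixes f :: "nat \<Rightarrow> real"
  assumes "{u, v, w} = {1, 2, 3::nat}"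
  shows "(\<Sum>h\<in>{1, 2, 3}. f h) = f u + f v + f w"
proof -
  have "u \<noteq> v" "u \<noteq> w" "v \<noteq> w" using assms by (blast elim: three_distinctE)+
  then show ?thesis unfolding assms[symmetric] by simp
qed

text \<open>\<open>L n h\<close> is the reduced load of machine \<open>h\<close> after ranks 0 to
  \<open>n - 1\<close>. The set equation makes \<open>u\<close>, \<open>v\<close>, \<open>w\<close>
  a permutation of the machines; its choice is left open under equal loads, so every tie-breaking is
  covered.\<close>

locale reduced_LD_run =
  fixes k :: nat and x y :: "nat \<Rightarrow> real" and L :: "nat \<Rightarrow> nat \<Rightarrow> real"
  assumes y_nonneg: "\<And>r. r < k \<Longrightarrow> 0 \<le> y r"
    and y_le_x: "\<And>r. r < k \<Longrightarrow> y r \<le> x r"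
    and start: "\<And>h. L 0 h = 0"
    and step: "\<And>r. r < k \<Longrightarrow> \<exists>u v w. {u, v, w} = {1, 2, 3} \<and>
      L r w \<le> L r v \<and> L r v \<le> L r u \<and>
      L (Suc r) u = L r u \<and> L (Suc r) v = L r v + y r \<and> L (Suc r) w = L r w + x r"
begin

lemma sum_loads: "n \<le> k \<Longrightarrow> (\<Sum>h\<in>{1, 2, 3}. L n h) = (\<Sum>r<n. x r + y r)"
proof (induction n)
  case 0
  then show ?case by (simp add: start)
next
  case (Suc n)
  then obtain u v w where uvw: "{u, v, w} = {1, 2, 3}" and
    "L (Suc n) u = L n u" "L (Suc n) v = L n v + y n" "L (Suc n) w = L n w + x n"
    using step[of n] by auto
  then show ?case using Suc sum_three[OF uvw, of "L n"] sum_three[OF uvw, of "L (Suc n)"] by simp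
qed

text \<open>While the machine just given \<open>x n\<close> stays least loaded, the gap cannot grow,
  as \<open>y n \<le> x n\<close>, and that machine keeps collecting. Once another machine takes
  over, the gap is at most \<open>x n\<close>. Indices start at 1 because \<open>load_bound\<close>
  pays with \<open>real q * x q\<close>, which vanishes at 0.\<close>

lemma gap_dichotomy:
  assumes "1 \<le> n" "n \<le> k" "{u, v, w} = {1, 2, 3}" "L n w \<le> L n v" "L n v \<le> L n u"
  shows "L n w = (\<Sum>q\<in>{1..<n}. x q) \<or> (\<exists>q\<in>{1..<n}. L n v - L n w \<le> x q)"
  using assms
proof (induction n arbitrary: u v w rule: nat_induct_at_least)
  case base
  then obtain a b c where abc: "{a, b, c} = {1, 2, 3}" and
    L: "L 1 a = 0" "L 1 b = y 0" "L 1 c = x 0"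
    using step[of 0] by (auto simp: start)
  have "0 \<le> y 0" "0 \<le> x 0" using y_nonneg[of 0] y_le_x[of 0] base by auto
  moreover have "a \<in> {u, v, w}" "w \<in> {a, b, c}" using abc base by auto
  ultimately have "L 1 w = 0" using base(3,4) L by auto
  then show ?case by simp
next
  case (Suc n)
  then obtain a b c where abc: "{a, b, c} = {1, 2, 3}" and
    ord: "L n c \<le> L n b" "L n b \<le> L n a" and
    L: "L (Suc n) a = L n a" "L (Suc n) b = L n b + y n" "L (Suc n) c = L n c + x n"
    using step[of n] by auto
  have xy: "0 \<le> y n" "y n \<le> x n" using y_nonneg[of n] y_le_x[of n] Suc by auto
  have "u \<noteq> v" "u \<noteq> w" "v \<noteq> w" using Suc.prems(2) by (blast elim: three_distinctE)+
  moreover have "u \<in> {a, b, c}" "v \<in> {a, b, c}" "w \<in> {a, b, c}"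
    using abc Suc.prems(2) by auto
  \<comment> \<open>If \<open>w\<close> is not \<open>c\<close>, then \<open>c\<close> is
    \<open>u\<close> or \<open>v\<close>, so the load of \<open>v\<close> is at most
    \<open>L n c + x n\<close>, while no load is below \<open>L n c\<close>.\<close>
  ultimately consider "w = c" "L (Suc n) v \<le> L n b + y n"
    | "L (Suc n) v - L (Suc n) w \<le> x n"
    using Suc.prems(3,4) L xy ord by auto
  then show ?case
  proof cases
    case 1
    from Suc.IH[of a b c] abc ord Suc.prems(1)
    have "L n c = (\<Sum>q\<in>{1..<n}. x q) \<or> (\<exists>q\<in>{1..<n}. L n b - L n c \<le> x q)" by simp
    then show ?thesis
    proof
      assume "L n c = (\<Sum>q\<in>{1..<n}. x q)"
      then show ?thesis using 1 L Suc.hyps by simp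
    next
      assume "\<exists>q\<in>{1..<n}. L n b - L n c \<le> x q"
      then obtain q where "q \<in> {1..<n}" "L n b - L n c \<le> x q" by blast
      moreover from this have "L (Suc n) v - L (Suc n) w \<le> x q" using 1 L xy by simp
      ultimately show ?thesis by (intro disjI2 bexI[of _ q]) auto
    qed
  next
    case 2
    then show ?thesis using Suc.hyps by (intro disjI2 bexI[of _ n]) auto
  qed
qed

lemma load_bound:
  assumes x_le: "\<And>r. r < k \<Longrightarrow> x r \<le> B"
    and yy_le: "\<And>q r. q < r \<Longrightarrow> r < k \<Longrightarrow> y q + y r \<le> B"
    and avg: "(\<Sum>r<k. x r + y r) \<le> 3 * B"
    and "0 \<le> B" "n \<le> k" "h \<in> {1, 2, 3}"
  shows "11 * L n h \<le> 13 * B + 2 * (\<Sum>r<n. real r * x r)"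
  using \<open>n \<le> k\<close> \<open>h \<in> {1, 2, 3}\<close>
proof (induction n arbitrary: h)
  case 0
  then show ?case using \<open>0 \<le> B\<close> by (simp add: start)
next
  case (Suc n)
  then have "n < k" by simp
  obtain a b c where abc: "{a, b, c} = {1, 2, 3}" and
    ord: "L n c \<le> L n b" "L n b \<le> L n a" and
    L: "L (Suc n) a = L n a" "L (Suc n) b = L n b + y n" "L (Suc n) c = L n c + x n"
    using step[OF \<open>n < k\<close>] by auto
  have xy: "0 \<le> y n" "y n \<le> x n" "x n \<le> B"
    using y_nonneg y_le_x x_le \<open>n < k\<close> by auto
  have x_nonneg: "0 \<le> x r" if "r < k" for r
    using y_nonneg[OF that] y_le_x[OF that] by simp
  define W where "W = (\<Sum>r<n. real r * x r)"
  have W_ge: "real q * x q \<le> W" if "q < n" for q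
    unfolding W_def using that \<open>n < k\<close>
    by (intro member_le_sum) (auto intro!: mult_nonneg_nonneg x_nonneg)
  have "0 \<le> W"
    unfolding W_def using \<open>n < k\<close> by (intro sum_nonneg) (auto intro!: mult_nonneg_nonneg x_nonneg)
  have "(\<Sum>r<Suc n. x r + y r) \<le> (\<Sum>r<k. x r + y r)"
    using \<open>n < k\<close> y_nonneg x_nonneg by (intro sum_mono2) (auto intro!: add_nonneg_nonneg)
  then have avg_n: "(\<Sum>r<n. x r + y r) + x n + y n \<le> 3 * B" using avg by simp
  have tot: "L n a + L n b + L n c = (\<Sum>r<n. x r + y r)"
    using sum_three[OF abc, of "L n"] sum_loads[of n] \<open>n < k\<close> by simp
  have n_mult: "real i * x n \<le> real n * x n" if "i \<le> n" for i
    using that x_nonneg[OF \<open>n < k\<close>] by (intro mult_right_mono) auto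
  have goal: "2 * (\<Sum>r<Suc n. real r * x r) = 2 * W + 2 * (real n * x n)"
    by (simp add: W_def)
  consider "h = a" | "h = b" | "h = c" using abc Suc.prems(2) by blast
  then show ?case
  proof cases
    case 1
    have "0 \<le> real n * x n" using n_mult[of 0] by simp
    then show ?thesis using Suc.IH[OF _ Suc.prems(2)] \<open>n < k\<close> goal 1 L unfolding W_def by simp
  next
    case 3
    \<comment> \<open>The average bound gives \<open>L n c + x n \<le> B + 2/3 * x n\<close>. For
      \<open>n \<ge> 3\<close> the term \<open>2 * n * x n\<close> and \<open>x n \<le> B\<close>
      absorb the excess; smaller \<open>n\<close> need explicit bounds on
      \<open>L n c\<close>.\<close>
    consider "n = 0" | "n = 1" | "n = 2" | "n \<ge> 3" by linarith
    then show ?thesis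
    proof cases
      assume "n = 0"
      then show ?thesis using 3 L start xy goal W_def by simp
    next
      assume n: "n = 1"
      obtain u v w where "{u, v, w} = {1, 2, 3}" "L 1 u = 0"
        using step[of 0] \<open>n < k\<close> by (auto simp: start)
      then have "u \<in> {a, b, c}" "L 1 u = 0" using abc by auto
      then have "L 1 c \<le> 0" using ord n by auto
      then show ?thesis using 3 L xy goal W_def n by simp
    next
      assume n: "n = 2"
      obtain u v w where uvw: "{u, v, w} = {1, 2, 3}" and
        o1: "L 1 w \<le> L 1 v" "L 1 v \<le> L 1 u" and L2: "L 2 w = L 1 w + x 1"
        using step[of 1] \<open>n < k\<close> n by (auto simp: numeral_2_eq_2)
      \<comment> \<open>At \<open>n = 1\<close> the index range of the dichotomy is empty, which
        leaves only the first alternative, with sum 0.\<close>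
      have "L 1 w = 0"
        using gap_dichotomy[OF _ _ uvw o1] \<open>n < k\<close> by simp
      moreover have "w \<in> {a, b, c}" using abc uvw by auto
      then have "L 2 c \<le> L 2 w" using ord n by auto
      ultimately have "L 2 c \<le> x 1" using L2 by simp
      moreover have "W = x 1" by (simp add: W_def n numeral_2_eq_2)
      \<comment> \<open>Adding twice \<open>L 2 c \<le> x 1\<close> to nine times the average bound
        \<open>L 2 c \<le> B - (x 2 + y 2) / 3\<close> leaves only
        \<open>4 * x 2 \<le> 4 * B\<close>.\<close>
      ultimately show ?thesis using 3 L xy goal n avg_n tot ord by simp
    next
      assume "n \<ge> 3"
      then show ?thesis using n_mult[of 3] 3 L xy goal avg_n tot ord \<open>0 \<le> W\<close> by simp
    qed
  next
    case 2
    consider "n = 0" | "n = 1" | "n \<ge> 2" by linarith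
    then show ?thesis
    proof cases
      assume "n = 0"
      then show ?thesis using 2 L start xy goal W_def by simp
    next
      assume n: "n = 1"
      obtain u v w where uvw: "{u, v, w} = {1, 2, 3}" and
        L1: "L 1 u = 0" "L 1 v = y 0" "L 1 w = x 0"
        using step[of 0] \<open>n < k\<close> by (auto simp: start)
      have "u \<noteq> v" "a \<noteq> b" "a \<noteq> c" "b \<noteq> c" using uvw abc by (blast elim: three_distinctE)+
      moreover have "a \<in> {u, v, w}" "b \<in> {u, v, w}" "u \<in> {a, b, c}" "v \<in> {a, b, c}"
        using abc uvw by auto
      moreover have "0 \<le> y 0" "y 0 \<le> x 0" using y_nonneg y_le_x \<open>n < k\<close> by auto
      \<comment> \<open>The middle one of the loads 0, \<open>y 0\<close>, \<open>x 0\<close> is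
        \<open>y 0\<close>.\<close>
      ultimately have "L 1 b \<le> y 0" using ord L1 n by auto
      then show ?thesis using yy_le[of 0 1] \<open>n < k\<close> 2 L xy goal W_def n by simp
    next
      assume n: "n \<ge> 2"
      from gap_dichotomy[OF _ _ abc ord] n \<open>n < k\<close>
      consider "L n c = (\<Sum>q\<in>{1..<n}. x q)"
        | q where "q \<in> {1..<n}" "L n b - L n c \<le> x q" by auto
      then show ?thesis
      proof cases
        case first: 1
        define X where "X = (\<Sum>q\<in>{1..<n}. x q)"
        define Y where "Y = (\<Sum>q\<in>{1..<n}. y q)"
        have split: "(\<Sum>q<n. f q) = f 0 + (\<Sum>q\<in>{1..<n}. f q)" for f :: "nat \<Rightarrow> real"
          using n by (simp add: sum.atLeast_Suc_lessThan lessThan_atLeast0)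
        have "(\<Sum>r<n. x r + y r) = x 0 + y 0 + X + Y"
          by (simp add: split X_def Y_def sum.distrib)
        moreover have "Y \<le> X"
          unfolding X_def Y_def using \<open>n < k\<close> y_le_x by (intro sum_mono) auto
        moreover have "X \<le> W"
        proof -
          have "X \<le> (\<Sum>q\<in>{1..<n}. real q * x q)"
            unfolding X_def
          proof (rule sum_mono)
            fix q assume q: "q \<in> {1..<n}"
            then have "1 * x q \<le> real q * x q"
              using x_nonneg[of q] \<open>n < k\<close> by (intro mult_right_mono) auto
            then show "x q \<le> real q * x q" by simp
          qed
          then show ?thesis by (simp add: W_def split)
        qed
        moreover have "x 0 \<le> B" "y 0 + y n \<le> B" using x_le yy_le[of 0 n] n \<open>n < k\<close> by auto
        moreover have "0 \<le> Y"
          unfolding Y_def using \<open>n < k\<close> y_nonneg by (intro sum_nonneg) auto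
        \<comment> \<open>Here \<open>2 * L n b \<le> x 0 + y 0 + Y\<close>. Four times the average
          bound plus seven times each of \<open>x 0 \<le> B\<close> and
          \<open>y 0 + y n \<le> B\<close> yields \<open>26 * B\<close>, twice the allowance;
          \<open>Y \<le> X \<le> W\<close> and \<open>y n \<le> x n\<close> cover the rest.\<close>
        ultimately show ?thesis
          using first 2 L xy goal n_mult[OF n] tot ord avg_n unfolding X_def[symmetric] by simp
      next
        case (2 q)
        then have "x q \<le> W"
          using W_ge[of q] mult_right_mono[of 1 "real q" "x q"] x_nonneg[of q] \<open>n < k\<close> by auto
        moreover have "x q \<le> B" using x_le 2 \<open>n < k\<close> by auto
        \<comment> \<open>Averaging gives \<open>L n b + y n \<le> B + (x q + y n) / 3\<close>; the
          excess in \<open>x q\<close> is charged partly to \<open>W\<close> and partly to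
          \<open>B\<close>.\<close>
        ultimately show ?thesis
          using \<open>h = b\<close> 2 L xy goal n_mult[OF n] tot ord avg_n by simp
      qed
    qed
  qed
qed

end


section \<open>Lower bounds from a competing schedule\<close>

lemma reduced_lower_bounds:
  fixes x y :: "nat \<Rightarrow> real" and z :: "nat \<Rightarrow> nat \<Rightarrow> real"
  assumes y_nonneg: "\<And>r. r < k \<Longrightarrow> 0 \<le> y r"
    and y_le_x: "\<And>r. r < k \<Longrightarrow> y r \<le> x r"
    and z: "\<And>r. r < k \<Longrightarrow> \<exists>u v w. {u, v, w} = {1, 2, 3} \<and> z r u = x r \<and> z r v = y r \<and> z r w = 0"
    and B: "\<And>h. h \<in> {1, 2, 3} \<Longrightarrow> (\<Sum>r<k. z r h) \<le> B"
  shows "r < k \<Longrightarrow> x r \<le> B"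
    and "q < r \<Longrightarrow> r < k \<Longrightarrow> y q + y r \<le> B"
    and "(\<Sum>r<k. x r + y r) \<le> 3 * B"
    and "0 \<le> B"
proof -
  have z_nonneg: "0 \<le> z r h" if "r < k" "h \<in> {1, 2, 3}" for r h
  proof -
    obtain u v w where uvw: "{u, v, w} = {1, 2, 3}" and z: "z r u = x r" "z r v = y r" "z r w = 0"
      using z[OF \<open>r < k\<close>] by blast
    have "h \<in> {u, v, w}" unfolding uvw by fact
    then show ?thesis using z y_nonneg[OF \<open>r < k\<close>] y_le_x[OF \<open>r < k\<close>] by auto
  qed
  show "x r \<le> B" if r: "r < k"
  proof -
    obtain u v w where "{u, v, w} = {1, 2, 3}" "z r u = x r" using z[OF r] by blast
    then have "u \<in> {1, 2, 3}" by blast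
    then have "z r u \<le> (\<Sum>r<k. z r u)" using r z_nonneg by (intro member_le_sum) auto
    then show ?thesis using B[OF \<open>u \<in> {1, 2, 3}\<close>] \<open>z r u = x r\<close> by simp
  qed
  show "y q + y r \<le> B" if qr: "q < r" "r < k"
  proof -
    obtain u v w where r: "{u, v, w} = {1, 2, 3}" "z r u = x r" "z r v = y r" using z[OF qr(2)] by blast
    obtain a b c where q: "{a, b, c} = {1, 2, 3}" "z q a = x q" "z q b = y q" using z[of q] qr by auto
    have "u \<noteq> v" "a \<noteq> b" using r(1) q(1) by (blast elim: three_distinctE)+
    have "a \<in> {u, v, w}" "b \<in> {u, v, w}" using r(1) q(1) by blast+
    \<comment> \<open>In each of the two ranks, two of the three machines receive at least the
      \<open>y\<close> of that rank, so some machine does in both.\<close>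
    then obtain h where h: "h \<in> {a, b}" "h \<in> {u, v}" using \<open>a \<noteq> b\<close> by blast
    then have "h \<in> {1, 2, 3}" using q(1) by blast
    have "y q \<le> z q h" "y r \<le> z r h" using h q r y_le_x[of q] y_le_x[of r] qr by auto
    moreover have "(\<Sum>i\<in>{q, r}. z i h) \<le> (\<Sum>i<k. z i h)"
      using qr z_nonneg \<open>h \<in> {1, 2, 3}\<close> by (intro sum_mono2) auto
    ultimately show ?thesis using B[OF \<open>h \<in> {1, 2, 3}\<close>] qr by simp
  qed
  have "(\<Sum>r<k. x r + y r) = (\<Sum>r<k. \<Sum>h\<in>{1, 2, 3}. z r h)"
  proof (intro sum.cong refl)
    fix r assume "r \<in> {..<k}"
    then obtain u v w where "{u, v, w} = {1, 2, 3}" "z r u = x r" "z r v = y r" "z r w = 0"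
      using z[of r] by blast
    then show "x r + y r = (\<Sum>h\<in>{1, 2, 3}. z r h)" using sum_three[of u v w "z r"] by simp
  qed
  also have "\<dots> = (\<Sum>h\<in>{1, 2, 3}. \<Sum>r<k. z r h)" by (rule sum.swap)
  also have "\<dots> \<le> 3 * B" using B[of 1] B[of 2] B[of 3] by simp
  finally show "(\<Sum>r<k. x r + y r) \<le> 3 * B" .
  have "0 \<le> (\<Sum>r<k. z r 1)" using z_nonneg by (intro sum_nonneg) auto
  then show "0 \<le> B" using B[of 1] by simp
qed

section \<open>Machine loads and makespan of flowtime-optimal schedules\<close>

definition rank_job :: "nat \<Rightarrow> (nat \<Rightarrow> nat) \<Rightarrow> nat \<Rightarrow> nat \<Rightarrow> nat" where
  "rank_job m s r h = inv_into (rank_jobs m r) s h"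

text \<open>This identifies \<open>load_before\<close> at \<open>Suc k\<close> with the full load of
  a machine.\<close>

lemma jobs_eq_UN_rank_jobs:
  assumes "m \<ge> 1"
  shows "jobs m k = (\<Union>q\<in>{1..<Suc k}. rank_jobs m q)"
proof (intro equalityI subsetI)
  fix i assume i: "i \<in> jobs m k"
  then have "(i - 1) div m < k" using assms by (auto simp: jobs_def less_mult_imp_div_less mult.commute)
  moreover have "i \<in> rank_jobs m (job_rank m i)"
    using i assms by (subst mem_rank_jobs_iff) (auto simp: jobs_def job_rank_def)
  ultimately show "i \<in> (\<Union>q\<in>{1..<Suc k}. rank_jobs m q)" by (force simp: job_rank_def)
next
  fix i assume "i \<in> (\<Union>q\<in>{1..<Suc k}. rank_jobs m q)"
  then obtain q where "q < Suc k" "i \<in> rank_jobs m q" by auto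
  then have "q \<le> k" "1 \<le> i" "i \<le> q * m" by (auto simp: rank_jobs_def)
  moreover have "q * m \<le> m * k" using \<open>q \<le> k\<close> by simp
  ultimately have "i \<le> m * k" using le_trans by blast
  then show "i \<in> jobs m k" using \<open>1 \<le> i\<close> by (simp add: jobs_def)
qed

context
  fixes m k :: nat and s :: "nat \<Rightarrow> nat"
  assumes m: "m \<ge> 1" and s: "s \<in> flowtime_optimal_schedules m k"
begin

lemma rank_bij: "r \<in> {1..k} \<Longrightarrow> bij_betw s (rank_jobs m r) (machines m)"
  using s by (auto simp: flowtime_optimal_schedules_def)

lemma rank_job_eq: "r \<in> {1..k} \<Longrightarrow> i \<in> rank_jobs m r \<Longrightarrow> rank_job m s r (s i) = i"
  unfolding rank_job_def using rank_bij by (auto simp: bij_betw_def)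

lemma rank_job_in: "r \<in> {1..k} \<Longrightarrow> h \<in> machines m \<Longrightarrow> rank_job m s r h \<in> rank_jobs m r"
  unfolding rank_job_def by (metis bij_betw_def inv_into_into rank_bij)

lemma machine_rank_job: "r \<in> {1..k} \<Longrightarrow> h \<in> machines m \<Longrightarrow> s (rank_job m s r h) = h"
  unfolding rank_job_def by (metis bij_betw_def f_inv_into_f rank_bij)

lemma load_before_Suc:
  assumes r: "r \<in> {1..k}" and h: "h \<in> machines m"
  shows "load_before m p s (Suc r) h = load_before m p s r h + p (rank_job m s r h)"
proof -
  let ?j = "rank_job m s r h" and ?A = "{i \<in> (\<Union>q\<in>{1..<r}. rank_jobs m q). s i = h}"
  have j: "?j \<in> rank_jobs m r" "s ?j = h"
    using rank_job_in[OF r h] machine_rank_job[OF r h] by auto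
  have "{1..<Suc r} = insert r {1..<r}" using r by auto
  then have eq: "{i \<in> (\<Union>q\<in>{1..<Suc r}. rank_jobs m q). s i = h} = insert ?j ?A"
    using j rank_job_eq[OF r] by auto
  have "job_rank m ?j = r" using j(1) r m by (simp add: mem_rank_jobs_iff)
  then have "?j \<notin> ?A" using m by (auto simp: mem_rank_jobs_iff)
  moreover have "finite ?A" by (auto simp: rank_jobs_def)
  ultimately show ?thesis unfolding load_before_def eq by simp
qed

lemma load_before_eq_sum:
  assumes "h \<in> machines m"
  shows "n \<le> k \<Longrightarrow> load_before m p s (Suc n) h = (\<Sum>r<n. p (rank_job m s (Suc r) h))"
proof (induction n)
  case 0
  then show ?case by (simp add: load_before_def)
next
  case (Suc n)
  then show ?case using load_before_Suc[of "Suc n" h p] assms by simp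
qed

lemma makespan_le:
  assumes "FM_instance m k p" and D: "\<And>h. h \<in> machines m \<Longrightarrow> load_before m p s (Suc k) h \<le> D"
  shows "makespan m k p s \<le> D"
proof -
  have nn: "\<And>i. i \<in> jobs m k \<Longrightarrow> 0 \<le> p i" and k: "k \<ge> 1"
    using assms(1) by (auto simp: FM_instance_def)
  have fin: "finite (jobs m k)" by (simp add: jobs_def)
  have "machine_completion m k p s h \<le> D" if h: "h \<in> machines m" for h
  proof -
    \<comment> \<open>A witness that the set under \<open>Max\<close> is nonempty.\<close>
    have "rank_job m s 1 h \<in> {j \<in> jobs m k. s j = h}"
      using rank_job_in[OF _ h, of 1] machine_rank_job[OF _ h, of 1] k
      by (auto simp: jobs_eq_UN_rank_jobs[OF m])
    moreover have "job_completion m k p s j \<le> D" if "j \<in> jobs m k" "s j = h" for j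
    proof -
      have "job_completion m k p s j \<le> (\<Sum>i\<in>{i \<in> jobs m k. s i = h}. p i)"
        unfolding job_completion_def using fin nn that by (intro sum_mono2) auto
      also have "\<dots> = load_before m p s (Suc k) h"
        by (simp add: load_before_def jobs_eq_UN_rank_jobs[OF m])
      finally show ?thesis using D[OF h] by simp
    qed
    ultimately show ?thesis
      unfolding machine_completion_def using fin by (subst Max_le_iff) auto
  qed
  then show ?thesis unfolding makespan_def using m by (subst Max_le_iff) (auto simp: machines_def)
qed

text \<open>The rank 1 job runs last, so its completion time is the full load of its
  machine.\<close>

lemma load_le_makespan:
  assumes "k \<ge> 1" and h: "h \<in> machines m"
  shows "load_before m p s (Suc k) h \<le> makespan m k p s"
proof -
  let ?j = "rank_job m s 1 h"
  have j: "?j \<in> rank_jobs m 1" "s ?j = h"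
    using rank_job_in[OF _ h, of 1] machine_rank_job[OF _ h, of 1] \<open>k \<ge> 1\<close> by auto
  then have "job_rank m ?j = 1" "?j \<in> jobs m k"
    using m \<open>k \<ge> 1\<close> by (auto simp: mem_rank_jobs_iff jobs_eq_UN_rank_jobs[OF m])
  have "load_before m p s (Suc k) h = job_completion m k p s ?j"
    unfolding job_completion_def load_before_def jobs_eq_UN_rank_jobs[OF m, symmetric]
      \<open>job_rank m ?j = 1\<close> j(2) by (simp add: job_rank_def)
  also have "\<dots> \<le> machine_completion m k p s h"
    unfolding machine_completion_def using j \<open>?j \<in> jobs m k\<close>
    by (intro Max_ge) (auto simp: jobs_def)
  also have "\<dots> \<le> makespan m k p s"
    unfolding makespan_def using h by (intro Max_ge) (auto simp: machines_def)
  finally show ?thesis .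
qed

end

section \<open>Reducing a concrete instance and restoring the subtracted amounts\<close>

lemma machines_3: "machines 3 = {1, 2, 3}"
  by (auto simp: machines_def)

lemma rank_jobs_3: "rank_jobs 3 (Suc r) = {3 * r + 1, 3 * r + 2, 3 * r + 3}"
  by (auto simp: rank_jobs_def)

lemma LD_bound_3:
  assumes inst: "FM_instance 3 k p" and LD: "LD_schedule 3 k p s"
    and t: "t \<in> flowtime_optimal_schedules 3 k"
  shows "makespan 3 k p s \<le> 13 / 11 * makespan 3 k p t"
proof -
  define c where "c r = p (3 * r + 3)" for r
  define x where "x r = p (3 * r + 1) - c r" for r
  define y where "y r = p (3 * r + 2) - c r" for r
  define C where "C = (\<Sum>r<k. c r)"
  have k: "k \<ge> 1" using inst by (simp add: FM_instance_def)
  have m: "(3::nat) \<ge> 1" by simp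
  have s: "s \<in> flowtime_optimal_schedules 3 k" by (rule LD_schedule_imp_flowtime_optimal[OF LD])
  have mono: "p j \<le> p i" if "1 \<le> i" "i \<le> j" "j \<le> 3 * k" for i j
    using inst that by (auto simp: FM_instance_def jobs_def monotone_on_def)
  have y_nonneg: "0 \<le> y r" and y_le_x: "y r \<le> x r" if "r < k" for r
    using that by (auto simp: x_def y_def c_def intro!: mono)
  have c_nonneg: "0 \<le> c r" if "r < k" for r
    using inst that by (auto simp: c_def FM_instance_def jobs_def)
  \<comment> \<open>The extra term carries the induction: \<open>x n + c n\<close> is the largest
    job of rank \<open>n\<close>, hence at most \<open>c (n - 1)\<close>, the smallest of the
    previous rank. At \<open>n = 0\<close> its factor is 0.\<close>
  have "n \<le> k \<Longrightarrow> (\<Sum>r<n. real r * x r) + real n * c (n - 1) \<le> (\<Sum>r<n. c r)" for n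
  proof (induction n)
    case 0
    then show ?case by simp
  next
    case (Suc n)
    have "real n * (x n + c n) \<le> real n * c (n - 1)"
    proof (cases n)
      case (Suc i)
      then show ?thesis using \<open>Suc n \<le> k\<close> by (auto simp: x_def c_def intro!: mult_left_mono mono)
    qed simp
    then show ?case using Suc by (simp add: algebra_simps)
  qed
  from this[of k] have weights: "(\<Sum>r<k. real r * x r) \<le> C"
    using c_nonneg[of "k - 1"] k by (auto simp: C_def intro: order_trans[rotated])

  let ?B = "makespan 3 k p t - C"
  have "\<exists>u v w. {u, v, w} = {1, 2, 3} \<and> p (rank_job 3 t (Suc r) u) - c r = x r \<and>
      p (rank_job 3 t (Suc r) v) - c r = y r \<and> p (rank_job 3 t (Suc r) w) - c r = 0"
    if r: "r < k" for r
  proof (intro exI conjI)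
    show "{t (3 * r + 1), t (3 * r + 2), t (3 * r + 3)} = {1, 2, 3}"
      using rank_bij[OF m t, of "Suc r"] r by (simp add: bij_betw_def rank_jobs_3 machines_3)
  qed (use r rank_job_eq[OF m t, of "Suc r"] in \<open>auto simp: rank_jobs_3 x_def y_def c_def\<close>)
  moreover have "(\<Sum>r<k. p (rank_job 3 t (Suc r) h) - c r) \<le> ?B" if "h \<in> {1, 2, 3}" for h
    using load_before_eq_sum[OF m t, of h k p] load_le_makespan[OF m t k, of h p] that
    by (simp add: machines_3 sum_subtractf C_def)
  ultimately have bounds: "\<And>r. r < k \<Longrightarrow> x r \<le> ?B" "\<And>q r. q < r \<Longrightarrow> r < k \<Longrightarrow> y q + y r \<le> ?B"
    "(\<Sum>r<k. x r + y r) \<le> 3 * ?B" "0 \<le> ?B"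
    using reduced_lower_bounds[of k y x "\<lambda>r h. p (rank_job 3 t (Suc r) h) - c r" ?B]
      y_nonneg y_le_x by blast+

  \<comment> \<open>Subtracting the same amount on all machines keeps their order, so the LD rule
    carries over. \<open>load_before\<close> counts ranks from 1, hence
    \<open>Suc r\<close>.\<close>
  define L where "L r h = load_before 3 p s (Suc r) h - (\<Sum>q<r. c q)" for r h
  interpret reduced_LD_run k x y L
  proof
    fix r assume r: "r < k"
    then have "Suc r \<in> {1..k}" by simp
    with LD obtain \<sigma> \<tau> :: "nat \<Rightarrow> nat" where \<sigma>: "bij_betw \<sigma> {1..3} (machines 3)"
        "mono_on {1..3} (\<lambda>i. load_before 3 p s (Suc r) (\<sigma> i))"
      and \<tau>: "bij_betw \<tau> {1..3} (rank_jobs 3 (Suc r))" "antimono_on {1..3} (\<lambda>i. p (\<tau> i))"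
      and s\<tau>: "\<forall>i\<in>{1..3}. s (\<tau> i) = \<sigma> i"
      unfolding LD_schedule_def by blast
    have L_Suc: "L (Suc r) (\<sigma> i) = L r (\<sigma> i) + p (\<tau> i) - c r" if i: "i \<in> {1..3}" for i
    proof -
      have "\<tau> i \<in> rank_jobs 3 (Suc r)" "\<sigma> i \<in> machines 3"
        using \<sigma>(1) \<tau>(1) i by (auto simp: bij_betw_def)
      then have "rank_job 3 s (Suc r) (\<sigma> i) = \<tau> i"
        using rank_job_eq[OF m s, of "Suc r" "\<tau> i"] s\<tau> i r by simp
      then show ?thesis
        using load_before_Suc[OF m s, of "Suc r" "\<sigma> i" p] r \<open>\<sigma> i \<in> machines 3\<close> by (simp add: L_def)
    qed
    have I: "{1..3} = {1, 2, 3::nat}" by auto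
    have ord: "p (\<tau> 3) \<le> p (\<tau> 2)" "p (\<tau> 2) \<le> p (\<tau> 1)"
      using \<tau>(2) by (auto simp: monotone_on_def)
    have "\<tau> 1 \<noteq> \<tau> 2" "\<tau> 1 \<noteq> \<tau> 3" "\<tau> 2 \<noteq> \<tau> 3"
      "\<tau> 1 \<in> rank_jobs 3 (Suc r)" "\<tau> 2 \<in> rank_jobs 3 (Suc r)" "\<tau> 3 \<in> rank_jobs 3 (Suc r)"
      using \<tau>(1) unfolding I by (auto simp: bij_betw_def)
    moreover have "p (3 * r + 3) \<le> p (3 * r + 2)" "p (3 * r + 2) \<le> p (3 * r + 1)"
      using r by (auto intro!: mono)
    \<comment> \<open>With equal jobs \<open>\<tau>\<close> may differ from the index order, but the
      sorted processing times agree.\<close>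
    ultimately have p\<tau>: "p (\<tau> 1) = p (3 * r + 1)" "p (\<tau> 2) = p (3 * r + 2)" "p (\<tau> 3) = p (3 * r + 3)"
      using ord unfolding rank_jobs_3 by auto
    show "\<exists>u v w. {u, v, w} = {1, 2, 3} \<and> L r w \<le> L r v \<and> L r v \<le> L r u \<and>
      L (Suc r) u = L r u \<and> L (Suc r) v = L r v + y r \<and> L (Suc r) w = L r w + x r"
    proof (intro exI conjI)
      show "{\<sigma> 3, \<sigma> 2, \<sigma> 1} = {1, 2, 3}"
        using \<sigma>(1) unfolding I machines_3 by (auto simp: bij_betw_def)
      show "L r (\<sigma> 1) \<le> L r (\<sigma> 2)" "L r (\<sigma> 2) \<le> L r (\<sigma> 3)"
        using \<sigma>(2) by (auto simp: monotone_on_def L_def)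
    qed (use p\<tau> in \<open>simp_all add: L_Suc x_def y_def c_def\<close>)
  qed (simp_all add: y_nonneg y_le_x L_def load_before_def)
  \<comment> \<open>Restoring \<open>C\<close> gives
    \<open>11 * (L k h + C) \<le> 13 * ?B + 2 * C + 11 * C\<close>, which is 13 times the makespan
    of \<open>t\<close>.\<close>
  have "load_before 3 p s (Suc k) h \<le> 13 / 11 * makespan 3 k p t" if "h \<in> machines 3" for h
    using load_bound[OF bounds, of k h] weights that by (simp add: L_def machines_3 C_def)
  then show ?thesis by (rule makespan_le[OF m s inst])
qed

theorem theorem7p15:
  "(\<forall>(k::nat) (p::nat \<Rightarrow> real) (s::nat \<Rightarrow> nat).
      FM_instance 3 k p \<longrightarrow> LD_schedule 3 k p s \<longrightarrow>
      makespan 3 k p s \<le> 13 / 11 * opt_makespan 3 k p) \<and>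
   Coffman_Sethi 3"
proof -
  have "makespan 3 k p s \<le> 13 / 11 * opt_makespan 3 k p"
    if "FM_instance 3 k p" "LD_schedule 3 k p s" for k p s
  proof -
    have "opt_makespan 3 k p \<in> makespan 3 k p ` flowtime_optimal_schedules 3 k"
      unfolding opt_makespan_def
      by (intro Min_in finite_imageI finite_flowtime_optimal_schedules)
        (simp add: flowtime_optimal_schedules_nonempty)
    then show ?thesis using LD_bound_3[OF that] by auto
  qed
  \<comment> \<open>At \<open>m = 3\<close> the conjectured ratio evaluates to 13/11.\<close>
  then show ?thesis by (simp add: Coffman_Sethi_def)
qed

end
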